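(* Let $(M,g)$ be a compact Riemannian surface without boundary, let $\gamma$ be a closed embedded geodesic of length $|\gamma|$ and let $n\ge1$ be an integer. Assume that $$|\gamma|^2\,\inf_\gamma K_g>\pi^2n^2 ,$$ where $K_g$ is the Gauss curvature along $\gamma$. Then $\gamma$ does not carry any Bouncing Jacobi Field with $n$ minimums.
   Context: $\gamma$ is parameterized by arc-length $s$ and identified with $\mathbf R/|\gamma|\mathbf Z$. The Jacobi operator is $\mathfrak J_\gamma:=-(\partial_s^2+K_g)$. $f(s_j^+)$ and $f(s_j^-)$ denote the limits of $f$ at $s_j$ from the right and from the left. Bouncing Jacobi Field with $n\ge1$ minimums: a function $\Phi:\gamma\to\mathbf R$ for which there exist $n$ distinct points $s_1,\dots,s_n\in\gamma$ such that $\Phi$ is continuous on $\gamma$, smooth on $\gamma-\{s_1,\dots,s_n\}$, $\mathfrak J_\gamma\Phi=0$ and $\Phi>1$ on $\gamma-\{s_1,\dots,s_n\}$, and $\Phi(s_j)=1$, $\partial_s\Phi(s_j^+)=-\partial_s\Phi(s_j^-)>0$ for all $j=1,\dots,n$. *)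

theory Defs
  imports "HOL-Analysis.Analysis"
begin

section \<open>Smooth maps on open sets\<close>

primrec higher_differentiable_on ::
    "'a::real_normed_vector set \<Rightarrow> ('a \<Rightarrow> 'b::real_normed_vector) \<Rightarrow> nat \<Rightarrow> bool" where
  "higher_differentiable_on S f 0 \<longleftrightarrow> continuous_on S f"
| "higher_differentiable_on S f (Suc k) \<longleftrightarrow>
     (\<forall>x\<in>S. f differentiable at x) \<and>
     (\<forall>v. higher_differentiable_on S (\<lambda>x. frechet_derivative f (at x) v) k)"

text \<open>Intended for open \<open>S\<close>: all derivatives are taken in the full space.\<close>

definition smooth_on ::
    "'a::real_normed_vector set \<Rightarrow> ('a \<Rightarrow> 'b::real_normed_vector) \<Rightarrow> bool" where
  "smooth_on S f \<longleftrightarrow> (\<forall>k. higher_differentiable_on S f k)"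

definition partial :: "2 \<Rightarrow> (real^2 \<Rightarrow> real) \<Rightarrow> real^2 \<Rightarrow> real" where
  "partial i f x = frechet_derivative f (at x) (axis i 1)"

section \<open>Compact Riemannian surfaces without boundary\<close>

text \<open>A chart is a coordinate domain together with a coordinate map; the values of the map
  outside the domain are irrelevant.  The metric is given by its coordinate matrix
  \<open>metric M c x\<close> in each chart \<open>c\<close> at each coordinate point \<open>x\<close>.\<close>

type_synonym 'm chart = "'m set \<times> ('m \<Rightarrow> real^2)"

record 'm surface =
  top_of :: "'m topology"
  atlas :: "'m chart set"
  metric :: "'m chart \<Rightarrow> real^2 \<Rightarrow> real^2^2"

abbreviation chart_dom :: "'m chart \<Rightarrow> 'm set" where
  "chart_dom \<equiv> fst"

abbreviation chart_map :: "'m chart \<Rightarrow> 'm \<Rightarrow> real^2" where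
  "chart_map \<equiv> snd"

abbreviation chart_image :: "'m chart \<Rightarrow> (real^2) set" where
  "chart_image c \<equiv> chart_map c ` chart_dom c"

definition transition :: "'m chart \<Rightarrow> 'm chart \<Rightarrow> real^2 \<Rightarrow> real^2" where
  "transition c d = chart_map d \<circ> inv_into (chart_dom c) (chart_map c)"

definition smooth_surface :: "'m surface \<Rightarrow> bool" where
  "smooth_surface M \<longleftrightarrow>
     Hausdorff_space (top_of M) \<and>
     (\<Union>c\<in>atlas M. chart_dom c) = topspace (top_of M) \<and>
     (\<forall>c\<in>atlas M.
        openin (top_of M) (chart_dom c) \<and> open (chart_image c) \<and>
        homeomorphic_map (subtopology (top_of M) (chart_dom c))
          (top_of_set (chart_image c)) (chart_map c)) \<and>
     (\<forall>c\<in>atlas M. \<forall>d\<in>atlas M.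
        smooth_on (chart_map c ` (chart_dom c \<inter> chart_dom d)) (transition c d))"

definition riemannian_metric :: "'m surface \<Rightarrow> bool" where
  "riemannian_metric M \<longleftrightarrow>
     (\<forall>c\<in>atlas M.
        smooth_on (chart_image c) (metric M c) \<and>
        (\<forall>x\<in>chart_image c.
           transpose (metric M c x) = metric M c x \<and>
           (\<forall>v. v \<noteq> 0 \<longrightarrow> 0 < v \<bullet> (metric M c x *v v)))) \<and>
     (\<forall>c\<in>atlas M. \<forall>d\<in>atlas M. \<forall>x\<in>chart_map c ` (chart_dom c \<inter> chart_dom d). \<forall>u v.
        let D = frechet_derivative (transition c d) (at x) in
          u \<bullet> (metric M c x *v v) = D u \<bullet> (metric M d (transition c d x) *v D v))"

text \<open>Charts map onto open subsets of the plane, so there is no boundary.  Second countability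
  follows from compactness.\<close>

definition compact_riemannian_surface :: "'m surface \<Rightarrow> bool" where
  "compact_riemannian_surface M \<longleftrightarrow>
     smooth_surface M \<and> riemannian_metric M \<and> compact_space (top_of M)"

section \<open>Christoffel symbols and Gauss curvature\<close>

text \<open>\<open>christoffel G k i j\<close> is \<open>\<Gamma>\<^sup>k\<^sub>i\<^sub>j\<close> for the coordinate metric \<open>G\<close>.\<close>

definition christoffel :: "(real^2 \<Rightarrow> real^2^2) \<Rightarrow> 2 \<Rightarrow> 2 \<Rightarrow> 2 \<Rightarrow> real^2 \<Rightarrow> real" where
  "christoffel G k i j x =
     (\<Sum>l\<in>UNIV. matrix_inv (G x) $ k $ l *
        (partial i (\<lambda>y. G y $ j $ l) x + partial j (\<lambda>y. G y $ i $ l) x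
          - partial l (\<lambda>y. G y $ i $ j) x)) / 2"

text \<open>\<open>riemann G l i j k\<close> is the \<open>l\<close>-th component of
  \<open>R(\<partial>\<^sub>i, \<partial>\<^sub>j) \<partial>\<^sub>k = \<nabla>\<^sub>i \<nabla>\<^sub>j \<partial>\<^sub>k - \<nabla>\<^sub>j \<nabla>\<^sub>i \<partial>\<^sub>k\<close>.\<close>

definition riemann :: "(real^2 \<Rightarrow> real^2^2) \<Rightarrow> 2 \<Rightarrow> 2 \<Rightarrow> 2 \<Rightarrow> 2 \<Rightarrow> real^2 \<Rightarrow> real" where
  "riemann G l i j k x =
     partial i (christoffel G l j k) x - partial j (christoffel G l i k) x
     + (\<Sum>m\<in>UNIV. christoffel G m j k x * christoffel G l i m x
                 - christoffel G m i k x * christoffel G l j m x)"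

text \<open>\<open>K = g(R(\<partial>\<^sub>1, \<partial>\<^sub>2) \<partial>\<^sub>2, \<partial>\<^sub>1) / det g\<close>, positive on round spheres.\<close>

definition coord_gauss_curvature :: "(real^2 \<Rightarrow> real^2^2) \<Rightarrow> real^2 \<Rightarrow> real" where
  "coord_gauss_curvature G x = (\<Sum>l\<in>UNIV. G x $ 1 $ l * riemann G l 1 2 2 x) / det (G x)"

text \<open>The coordinate expression has the same value in every chart around \<open>p\<close>; the choice of
  the chart is immaterial.\<close>

definition gauss_curvature :: "'m surface \<Rightarrow> 'm \<Rightarrow> real" where
  "gauss_curvature M p =
     (let c = (SOME c. c \<in> atlas M \<and> p \<in> chart_dom c)
      in coord_gauss_curvature (metric M c) (chart_map c p))"

section \<open>Closed embedded geodesics\<close>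

text \<open>A closed embedded geodesic of length \<open>L\<close> is given by an arc-length parametrization
  \<open>\<gamma>\<close> on the real line inducing an injection of \<open>\<real>/L\<int>\<close> into the surface; an injective
  immersion of a circle is an embedding.\<close>

definition unit_speed_geodesic :: "'m surface \<Rightarrow> (real \<Rightarrow> 'm) \<Rightarrow> bool" where
  "unit_speed_geodesic M \<gamma> \<longleftrightarrow>
     continuous_map euclideanreal (top_of M) \<gamma> \<and>
     (\<forall>c\<in>atlas M.
        let x = (\<lambda>t. chart_map c (\<gamma> t));
            x' = (\<lambda>t. vector_derivative x (at t));
            x'' = (\<lambda>t. vector_derivative x' (at t))
        in smooth_on {s. \<gamma> s \<in> chart_dom c} x \<and>
           (\<forall>s. \<gamma> s \<in> chart_dom c \<longrightarrow>
              x' s \<bullet> (metric M c (x s) *v x' s) = 1 \<and>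
              (\<forall>k. x'' s $ k
                 + (\<Sum>i\<in>UNIV. \<Sum>j\<in>UNIV.
                      christoffel (metric M c) k i j (x s) * x' s $ i * x' s $ j) = 0)))"

definition closed_embedded_geodesic :: "'m surface \<Rightarrow> (real \<Rightarrow> 'm) \<Rightarrow> real \<Rightarrow> bool" where
  "closed_embedded_geodesic M \<gamma> L \<longleftrightarrow>
     0 < L \<and> unit_speed_geodesic M \<gamma> \<and>
     (\<forall>s t. \<gamma> s = \<gamma> t \<longleftrightarrow> (\<exists>k::int. t - s = of_int k * L))"

section \<open>Bouncing Jacobi fields\<close>

definition jacobi_op :: "'m surface \<Rightarrow> (real \<Rightarrow> 'm) \<Rightarrow> (real \<Rightarrow> real) \<Rightarrow> real \<Rightarrow> real" where
  "jacobi_op M \<gamma> f s = - (deriv (deriv f) s + gauss_curvature M (\<gamma> s) * f s)"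

text \<open>\<open>\<Phi>\<close> is a function on the curve (its values off the curve are irrelevant) and \<open>P\<close> is the
  set of the \<open>n\<close> points \<open>s\<^sub>1, \<dots>, s\<^sub>n\<close> of the curve; analysis is done in the arc-length
  parameter, for \<open>f s = \<Phi> (\<gamma> s)\<close>.  The common value of \<open>\<partial>\<^sub>s\<Phi>(s\<^sub>j\<^sup>+)\<close> and
  \<open>- \<partial>\<^sub>s\<Phi>(s\<^sub>j\<^sup>-)\<close> is \<open>d\<close>.\<close>

definition bouncing_jacobi_field ::
    "'m surface \<Rightarrow> (real \<Rightarrow> 'm) \<Rightarrow> nat \<Rightarrow> ('m \<Rightarrow> real) \<Rightarrow> bool" where
  "bouncing_jacobi_field M \<gamma> n \<Phi> \<longleftrightarrow>
     (let f = (\<lambda>s. \<Phi> (\<gamma> s)) in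
      \<exists>P. P \<subseteq> range \<gamma> \<and> finite P \<and> card P = n \<and>
        continuous_on UNIV f \<and>
        smooth_on {s. \<gamma> s \<notin> P} f \<and>
        (\<forall>s. \<gamma> s \<notin> P \<longrightarrow> jacobi_op M \<gamma> f s = 0 \<and> f s > 1) \<and>
        (\<forall>s. \<gamma> s \<in> P \<longrightarrow> f s = 1 \<and>
           (\<exists>d>0. (deriv f \<longlongrightarrow> d) (at_right s) \<and> (deriv f \<longlongrightarrow> - d) (at_left s))))"

end

theory Submission
  imports Defs
begin

text \<open>Some gap between consecutive bouncing points has length at least \<open>L / n\<close>. On a subinterval
  of length \<open>L / n = \<pi> / \<omega>\<close> of this gap, the field is a positive solution of \<open>f'' + K f = 0\<close> with
  \<open>K > \<omega>\<^sup>2\<close>, which the Sturm comparison with \<open>sin (\<omega> (s - a))\<close> forbids.\<close>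

text \<open>The Wronskian \<open>W\<close> of \<open>f\<close> and
  \<open>sin (\<omega> * (x - a))\<close> has derivative
  \<open>(\<omega>\<^sup>2 - K x) * f x * sin (\<omega> * (x - a))\<close>, negative inside the
  interval since the sine is positive there; yet its limits at the two ends force it to rise. The
  equation is assumed only in the interior and \<open>f'\<close> only has one-sided limits at the
  ends, so that either end may be a bouncing point.\<close>

lemma sturm_no_positive_solution:
  fixes f f' K :: "real \<Rightarrow> real"
  assumes \<omega>: "\<omega> > 0" and c: "c = a + pi / \<omega>"
    and f: "\<And>x. a < x \<Longrightarrow> x < c \<Longrightarrow> (f has_real_derivative f' x) (at x)"
    and f': "\<And>x. a < x \<Longrightarrow> x < c \<Longrightarrow> (f' has_real_derivative - (K x * f x)) (at x)"
    and K: "\<And>x. a < x \<Longrightarrow> x < c \<Longrightarrow> K x > \<omega>\<^sup>2"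
    and cont: "continuous_on {a..c} f"
    and pos: "\<And>x. a \<le> x \<Longrightarrow> x \<le> c \<Longrightarrow> f x > 0"
    and da: "(f' \<longlongrightarrow> da) (at_right a)" and dc: "(f' \<longlongrightarrow> dc) (at_left c)"
  shows False
proof -
  define W where "W x = f' x * sin (\<omega> * (x - a)) - \<omega> * f x * cos (\<omega> * (x - a))" for x
  have ac: "a < c"
    using \<omega> c by simp
  have arg_c: "\<omega> * (c - a) = pi"
    using \<omega> c by simp
  have W_deriv: "(W has_real_derivative (\<omega>\<^sup>2 - K x) * f x * sin (\<omega> * (x - a))) (at x)"
    if "a < x" "x < c" for x
    unfolding W_def
    by (rule derivative_eq_intros f[OF that] f'[OF that] refl)+
      (simp add: algebra_simps power2_eq_square)
  have W_decr: "W y < W x" if "a < x" "x < y" "y < c" for x y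
  proof (rule DERIV_neg_imp_decreasing[OF \<open>x < y\<close>])
    fix z assume z: "x \<le> z" "z \<le> y"
    with that have az: "a < z" "z < c" by auto
    have "\<omega> * (z - a) < \<omega> * (c - a)"
      using az \<omega> by simp
    then have "sin (\<omega> * (z - a)) > 0"
      using az \<omega> by (intro sin_gt_zero) (auto simp: arg_c)
    moreover have "(\<omega>\<^sup>2 - K z) * f z < 0"
      using K[OF az] pos[of z] az by (intro mult_neg_pos) auto
    ultimately have "(\<omega>\<^sup>2 - K z) * f z * sin (\<omega> * (z - a)) < 0"
      using mult_neg_pos by blast
    then show "\<exists>D. (W has_real_derivative D) (at z) \<and> D < 0"
      using W_deriv[OF az] by blast
  qed
  have fa: "(f \<longlongrightarrow> f a) (at_right a)" and fc: "(f \<longlongrightarrow> f c) (at_left c)"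
    using continuous_on_Icc_at_rightD[OF cont ac] continuous_on_Icc_at_leftD[OF cont ac] by auto
  \<comment> \<open>The sine vanishes at both ends, which removes the limits \<open>da\<close> and
    \<open>dc\<close> of the slope, whatever their values; the cosine is 1 at \<open>a\<close> and
    -1 at \<open>c\<close>, which gives the two limits of \<open>W\<close> opposite signs.\<close>
  have "(W \<longlongrightarrow> da * sin (\<omega> * (a - a)) - \<omega> * f a * cos (\<omega> * (a - a))) (at_right a)"
    unfolding W_def by (intro tendsto_intros da fa)
  then have Wa: "(W \<longlongrightarrow> - \<omega> * f a) (at_right a)" by simp
  have "(W \<longlongrightarrow> dc * sin (\<omega> * (c - a)) - \<omega> * f c * cos (\<omega> * (c - a))) (at_left c)"
    unfolding W_def by (intro tendsto_intros dc fc)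
  then have Wc: "(W \<longlongrightarrow> \<omega> * f c) (at_left c)" by (simp add: arg_c)
  \<comment> \<open>Monotonicity holds only in the open interval, so the limits are compared with
    two interior values: \<open>W x\<close> is at most a negative number and \<open>W y\<close> at
    least a positive one, although \<open>W\<close> decreases.\<close>
  obtain x y where xy: "a < x" "x < y" "y < c"
    using ac dense by meson
  have "W x \<le> - \<omega> * f a"
  proof (rule tendsto_lowerbound[OF Wa])
    show "\<forall>\<^sub>F z in at_right a. W x \<le> W z"
      unfolding eventually_at_right_field using xy
        by (intro exI[of _ x]) (auto intro!: less_imp_le W_decr)
  qed simp
  moreover have "\<omega> * f c \<le> W y"
  proof (rule tendsto_upperbound[OF Wc])
    show "\<forall>\<^sub>F z in at_left c. W z \<le> W y"
      unfolding eventually_at_left_field using xy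
        by (intro exI[of _ y]) (auto intro!: less_imp_le W_decr)
  qed simp
  moreover have "\<omega> * f a > 0" "\<omega> * f c > 0"
    using \<omega> pos[of a] pos[of c] ac by auto
  ultimately show False
    using W_decr[OF xy] by simp
qed

text \<open>Pigeonhole: if every point of \<open>S\<close> had a later one at distance less than
  \<open>L / n\<close>, then \<open>n\<close> such steps from \<open>a0\<close> would cover less
  than \<open>L\<close> and put \<open>n + 1\<close> points of \<open>S\<close> into one half-open
  period. The gap found is open, so \<open>a + L / n\<close> may itself lie in
  \<open>S\<close>.\<close>

lemma exists_long_gap:
  fixes S :: "real set"
  assumes "a0 \<in> S" and n: "n \<ge> 1" and "L > 0"
    and fin: "\<And>t. finite (S \<inter> {t..<t + L})" and card: "\<And>t. card (S \<inter> {t..<t + L}) \<le> n"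
  shows "\<exists>a\<in>S. S \<inter> {a<..<a + L / n} = {}"
proof (rule ccontr)
  assume "\<not> ?thesis"
  then have "\<forall>a\<in>S. \<exists>b\<in>S. a < b \<and> b < a + L / n"
    by (fastforce simp: disjoint_iff)
  then obtain nxt where nxt: "\<And>a. a \<in> S \<Longrightarrow> nxt a \<in> S \<and> a < nxt a \<and> nxt a < a + L / n"
    by metis
  define p where "p i = (nxt ^^ i) a0" for i
  have pS: "p i \<in> S" for i
    by (induction i) (use nxt \<open>a0 \<in> S\<close> in \<open>auto simp: p_def\<close>)
  have p_Suc: "p i < p (Suc i)" "p (Suc i) < p i + L / n" for i
    using nxt[OF pS[of i]] by (simp_all add: p_def)
  have mono: "strict_mono p"
    using p_Suc(1) by (simp add: strict_mono_Suc_iff)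
  \<comment> \<open>The index starts at \<open>Suc 0\<close> because the strict inequality fails
    after zero steps.\<close>
  have bound: "p (Suc i) < a0 + Suc i * (L / n)" for i
  proof (induction i)
    case 0
    then show ?case using p_Suc(2)[of 0] by (simp add: p_def)
  next
    case (Suc i)
    have "a0 + Suc (Suc i) * (L / n) = a0 + Suc i * (L / n) + L / n"
      by (simp only: of_nat_Suc) (simp only: distrib_right mult_1_left add_ac)
    then show ?case using Suc p_Suc(2)[of "Suc i"] by linarith
  qed
  have "p i \<in> S \<inter> {a0..<a0 + L}" if "i \<le> n" for i
  proof -
    have "p 0 \<le> p i" "p i \<le> p n"
      using mono that by (simp_all add: strict_mono_less_eq)
    moreover have "p n < a0 + L"
      using bound[of "n - 1"] n by simp
    ultimately show ?thesis using pS by (auto simp: p_def)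
  qed
  then have "p ` {..n} \<subseteq> S \<inter> {a0..<a0 + L}" by auto
  then have "card (p ` {..n}) \<le> n"
    using card_mono[OF fin] card order_trans by blast
  moreover have "card (p ` {..n}) = Suc n"
    using mono by (simp add: card_image strict_mono_imp_inj_on inj_on_subset)
  ultimately show False by simp
qed

text \<open>Links the derivatives in \<open>smooth_on\<close>, which are Frechet derivatives, with
  the \<open>deriv\<close> of \<open>jacobi_op\<close> and of the bouncing condition.\<close>

lemma frechet_derivative_1_eq_deriv:
  fixes f :: "real \<Rightarrow> real"
  assumes "f differentiable at x"
  shows "frechet_derivative f (at x) 1 = deriv f x"
    and "(f has_real_derivative deriv f x) (at x)"
proof -
  have der: "(f has_real_derivative deriv f x) (at x)"
    using assms DERIV_deriv_iff_real_differentiable by blast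
  then show "(f has_real_derivative deriv f x) (at x)" .
  show "frechet_derivative f (at x) 1 = deriv f x"
    using fun_cong[OF frechet_derivative_at[OF der[unfolded has_field_derivative_def]], of 1] by simp
qed

theorem lemma2p6:
  fixes M :: "'m surface" and \<gamma> :: "real \<Rightarrow> 'm" and L :: real and n :: nat
  assumes "compact_riemannian_surface M"
    and "closed_embedded_geodesic M \<gamma> L"
    and "n \<ge> 1"
    and "ereal (L\<^sup>2) * (INF p\<in>range \<gamma>. ereal (gauss_curvature M p)) > ereal (pi\<^sup>2 * (real n)\<^sup>2)"
  shows "\<not> (\<exists>\<Phi>. bouncing_jacobi_field M \<gamma> n \<Phi>)"
proof
  assume "\<exists>\<Phi>. bouncing_jacobi_field M \<gamma> n \<Phi>"
  then obtain \<Phi> where "bouncing_jacobi_field M \<gamma> n \<Phi>" ..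
  then obtain P where P: "P \<subseteq> range \<gamma>" "finite P" "card P = n"
    and cont: "continuous_on UNIV (\<lambda>s. \<Phi> (\<gamma> s))"
    and smooth: "smooth_on {s. \<gamma> s \<notin> P} (\<lambda>s. \<Phi> (\<gamma> s))"
    and off: "\<And>s. \<gamma> s \<notin> P \<Longrightarrow> jacobi_op M \<gamma> (\<lambda>s. \<Phi> (\<gamma> s)) s = 0 \<and> \<Phi> (\<gamma> s) > 1"
    and on: "\<And>s. \<gamma> s \<in> P \<Longrightarrow> \<Phi> (\<gamma> s) = 1 \<and>
           (\<exists>d>0. (deriv (\<lambda>s. \<Phi> (\<gamma> s)) \<longlongrightarrow> d) (at_right s) \<and>
                  (deriv (\<lambda>s. \<Phi> (\<gamma> s)) \<longlongrightarrow> - d) (at_left s))"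
    unfolding bouncing_jacobi_field_def Let_def by blast
  define f where "f s = \<Phi> (\<gamma> s)" for s
  \<comment> \<open>The lift of the bouncing points to the parameter line.\<close>
  define S where "S = {s. \<gamma> s \<in> P}"
  define K where "K s = gauss_curvature M (\<gamma> s)" for s
  \<comment> \<open>This value makes \<open>pi / \<omega>\<close> equal to \<open>L / n\<close> and
    turns the curvature hypothesis into \<open>K s > \<omega>\<^sup>2\<close>.\<close>
  define \<omega> where "\<omega> = pi * n / L"
  have L: "L > 0" and \<gamma>_eq: "\<And>s t. \<gamma> s = \<gamma> t \<longleftrightarrow> (\<exists>k::int. t - s = of_int k * L)"
    using assms(2) unfolding closed_embedded_geodesic_def by auto
  have \<omega>: "\<omega> > 0"
    using L assms(3) by (simp add: \<omega>_def)

  have K: "K s > \<omega>\<^sup>2" for s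
  proof -
    have "(INF p\<in>range \<gamma>. ereal (gauss_curvature M p)) \<le> ereal (K s)"
      unfolding K_def by (intro INF_lower) auto
    then have "ereal (L\<^sup>2) * (INF p\<in>range \<gamma>. ereal (gauss_curvature M p)) \<le> ereal (L\<^sup>2) * ereal (K s)"
      by (intro ereal_mult_left_mono) auto
    with assms(4) have "ereal (pi\<^sup>2 * (real n)\<^sup>2) < ereal (L\<^sup>2) * ereal (K s)"
      by (rule less_le_trans)
    then have "pi\<^sup>2 * (real n)\<^sup>2 < L\<^sup>2 * K s" by simp
    then show ?thesis
      using L by (simp add: \<omega>_def power_divide power_mult_distrib field_simps)
  qed

  have inj: "inj_on \<gamma> {t..<t + L}" for t
  proof (rule inj_onI)
    fix x y assume xy: "x \<in> {t..<t + L}" "y \<in> {t..<t + L}" and "\<gamma> x = \<gamma> y"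
    then obtain k :: int where k: "y - x = of_int k * L" using \<gamma>_eq by blast
    then have "\<bar>of_int k * L\<bar> < 1 * L" using xy by auto
    then have "\<bar>of_int k\<bar> < (1::real)" using L by (simp add: abs_mult)
    then have "k = 0" by linarith
    with k show "x = y" by simp
  qed
  \<comment> \<open>Within one half-open period \<open>\<gamma>\<close> is injective and maps
    \<open>S\<close> into \<open>P\<close>, which has \<open>n\<close> elements.\<close>
  have S_period: "finite (S \<inter> {t..<t + L})" "card (S \<inter> {t..<t + L}) \<le> n" for t
  proof -
    have inj': "inj_on \<gamma> (S \<inter> {t..<t + L})"
      using inj inj_on_subset by blast
    have sub: "\<gamma> ` (S \<inter> {t..<t + L}) \<subseteq> P"
      by (auto simp: S_def)
    show "finite (S \<inter> {t..<t + L})"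
      using inj' sub P(2) by (rule inj_on_finite)
    show "card (S \<inter> {t..<t + L}) \<le> n"
      using card_inj_on_le[OF inj' sub P(2)] P(3) by simp
  qed
  have "P \<noteq> {}"
    using P(3) assms(3) by auto
  then obtain a0 where "a0 \<in> S"
    using P(1) by (auto simp: S_def)
  then obtain a where a: "a \<in> S" and gap: "S \<inter> {a<..<a + L / n} = {}"
    using exists_long_gap[OF _ assms(3) L S_period] by blast
  define c where "c = a + L / n"
  have c: "c = a + pi / \<omega>"
    by (simp add: c_def \<omega>_def)
  have ac: "a < c" using L assms(3) by (simp add: c_def)
  have gap': "x \<notin> S" if "a < x" "x < c" for x
    using gap that by (auto simp: c_def)

  \<comment> \<open>Two unfoldings of \<open>higher_differentiable_on\<close>, the first derivative
    being taken in direction 1.\<close>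
  have smooth': "f differentiable at x" "(\<lambda>x. frechet_derivative f (at x) 1) differentiable at x"
    if "x \<notin> S" for x
    using smooth[unfolded smooth_on_def, rule_format, of "Suc (Suc 0)"] that
    by (auto simp: S_def f_def[abs_def])
  have f_der: "(f has_real_derivative deriv f x) (at x)" if "a < x" "x < c" for x
    using frechet_derivative_1_eq_deriv(2) smooth'(1) gap'[OF that] by blast
  have f'_eq: "frechet_derivative f (at x) 1 = deriv f x" if "a < x" "x < c" for x
    using frechet_derivative_1_eq_deriv(1) smooth'(1) gap'[OF that] by blast
  have f'_der: "(deriv f has_real_derivative - (K x * f x)) (at x)" if x: "a < x" "x < c" for x
  proof -
    obtain D where "((\<lambda>x. frechet_derivative f (at x) 1) has_derivative D) (at x)"
      using smooth'(2)[OF gap'[OF x]] unfolding differentiable_def by blast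
    \<comment> \<open>The two forms of the first derivative are known to agree on the open gap, a
      neighbourhood of \<open>x\<close>, so differentiability passes from one to the other.\<close>
    then have "(deriv f has_derivative D) (at x)"
      by (rule has_derivative_transform_within_open[where s = "{a<..<c}"]) (use x f'_eq in auto)
    then have "deriv f differentiable at x"
      unfolding differentiable_def by blast
    then have "(deriv f has_real_derivative deriv (deriv f) x) (at x)"
      using frechet_derivative_1_eq_deriv(2) by blast
    moreover have "deriv (deriv f) x = - (K x * f x)"
    proof -
      have "jacobi_op M \<gamma> f x = 0"
        using off[of x] gap'[OF x] by (simp add: S_def f_def[abs_def])
      then show ?thesis
        unfolding jacobi_op_def K_def by linarith
    qed
    ultimately show ?thesis by simp
  qed
  have f_eta: "deriv (\<lambda>s. \<Phi> (\<gamma> s)) = deriv f"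
    by (simp add: f_def[abs_def])
  obtain da where da: "(deriv f \<longlongrightarrow> da) (at_right a)"
    using on[of a] a by (auto simp: S_def f_eta)
  \<comment> \<open>The gap may extend beyond \<open>c\<close>. If \<open>c\<close> is a bouncing
    point, the limit is part of the bouncing condition, as at \<open>a\<close>; otherwise the field
    is smooth at \<open>c\<close> and the limit comes from continuity of its derivative.\<close>
  have "\<exists>dc. (deriv f \<longlongrightarrow> dc) (at_left c)"
  proof (cases "c \<in> S")
    case True
    then show ?thesis using on[of c] by (auto simp: S_def f_eta)
  next
    case False
    let ?g = "\<lambda>x. frechet_derivative f (at x) 1"
    have "(?g \<longlongrightarrow> ?g c) (at_left c)"
      using differentiable_imp_continuous_within[OF smooth'(2)[OF False]]
      unfolding continuous_within by (rule tendsto_within_subset) simp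
    moreover have "\<forall>\<^sub>F x in at_left c. ?g x = deriv f x"
      unfolding eventually_at_left_field using ac f'_eq by blast
    ultimately show ?thesis
      using tendsto_cong by metis
  qed
  then obtain dc where dc: "(deriv f \<longlongrightarrow> dc) (at_left c)" ..
  have f_cont: "continuous_on {a..c} f"
    using continuous_on_subset[OF cont subset_UNIV] by (simp add: f_def[abs_def])
  have f_pos: "f x > 0" for x
    using on[of x] off[of x] by (cases "\<gamma> x \<in> P") (auto simp: f_def)
  show False
    using sturm_no_positive_solution[OF \<omega> c f_der f'_der K f_cont f_pos da dc] .
qed

end
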